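(* Stable $k$-positive discrete-time LTI systems are in general not diagonally stable. Specifically, let $$A=\frac17\begin{bmatrix}-4&-2&1\\1&-3&-5\\7&1&-2\end{bmatrix}\in\mathbb{R}^{3\times 3}.$$ Then $A$ is Schur (i.e. its spectral radius satisfies $\rho(A)<1$) and the discrete-time LTI system $x(j+1)=Ax(j)$ is strongly $2$-positive, but there is no diagonal matrix $D\in\mathbb{R}^{3\times 3}$ with positive diagonal entries such that $A^TDA\prec D$.
   Context: For symmetric matrices, $P\prec Q$ means that $Q-P$ is positive-definite. For $x\in\mathbb{R}^n$, $x\neq 0$, let $s^-(x)$ be the number of sign variations in $x$ after deleting all its zero entries, and set $s^-(0)=0$. Let $s^+(x)$ be the maximal possible number of sign variations in $x$ after each zero entry is replaced by either $1$ or $-1$. For $k\in\{1,\dots,n\}$ let $P^k_-=\{x\in\mathbb{R}^n: s^-(x)\le k-1\}$ and $P^k_+=\{x\in\mathbb{R}^n: s^+(x)\le k-1\}$. The discrete-time LTI system $x(j+1)=Ax(j)$ is called strongly $k$-positive if its dynamics maps $P^k_-\setminus\{0\}$ into $P^k_+$, i.e. $A(P^k_-\setminus\{0\})\subseteq P^k_+$. *)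

theory Defs
  imports "Jordan_Normal_Form.Spectral_Radius"
begin

text \<open>Sign variations of a list; only meant for lists without zero entries.\<close>

definition sign_variations :: "real list \<Rightarrow> nat" where
  "sign_variations ys = card {i. Suc i < length ys \<and> ys ! i * ys ! Suc i < 0}"

text \<open>The convention \<open>s_minus 0 = 0\<close> needs no separate clause: deleting the zero entries
  of a zero vector leaves the empty list.\<close>

definition s_minus :: "real vec \<Rightarrow> nat" where
  "s_minus x = sign_variations (filter (\<lambda>a. a \<noteq> 0) (list_of_vec x))"

definition zero_replacements :: "real vec \<Rightarrow> real list set" where
  "zero_replacements x = {ys. length ys = dim_vec x \<and>
     (\<forall>i<dim_vec x. if x $ i = 0 then ys ! i \<in> {1, -1} else ys ! i = x $ i)}"

definition s_plus :: "real vec \<Rightarrow> nat" where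
  "s_plus x = Max (sign_variations ` zero_replacements x)"

text \<open>The truncated subtraction is harmless, as these sets are only used for \<open>1 \<le> k\<close>.\<close>

definition P_minus :: "nat \<Rightarrow> nat \<Rightarrow> real vec set" where
  "P_minus n k = {x \<in> carrier_vec n. s_minus x \<le> k - 1}"

definition P_plus :: "nat \<Rightarrow> nat \<Rightarrow> real vec set" where
  "P_plus n k = {x \<in> carrier_vec n. s_plus x \<le> k - 1}"

text \<open>The system \<open>x (j + 1) = A x j\<close> on $\mathbb{R}^n$ is represented by its matrix \<open>A\<close>.\<close>

definition strongly_k_positive :: "nat \<Rightarrow> nat \<Rightarrow> real mat \<Rightarrow> bool" where
  "strongly_k_positive n k A \<longleftrightarrow> A \<in> carrier_mat n n \<and> 1 \<le> k \<and> k \<le> n \<and>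
     (\<lambda>x. A *\<^sub>v x) ` (P_minus n k - {0\<^sub>v n}) \<subseteq> P_plus n k"

definition schur :: "real mat \<Rightarrow> bool" where
  "schur A \<longleftrightarrow> spectral_radius (map_mat complex_of_real A) < 1"

definition positive_definite :: "nat \<Rightarrow> real mat \<Rightarrow> bool" where
  "positive_definite n M \<longleftrightarrow> M \<in> carrier_mat n n \<and> M\<^sup>T = M \<and>
     (\<forall>x \<in> carrier_vec n. x \<noteq> 0\<^sub>v n \<longrightarrow> x \<bullet> (M *\<^sub>v x) > 0)"

text \<open>The order is only considered between symmetric matrices; the explicit carriers matter
  because matrix subtraction is unspecified outside the common dimensions.\<close>

definition mat_prec :: "nat \<Rightarrow> real mat \<Rightarrow> real mat \<Rightarrow> bool" where
  "mat_prec n P Q \<longleftrightarrow> P \<in> carrier_mat n n \<and> Q \<in> carrier_mat n n \<and> P\<^sup>T = P \<and> Q\<^sup>T = Q \<and>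
     positive_definite n (Q - P)"

definition A_counterexample :: "real mat" where
  "A_counterexample = (1/7) \<cdot>\<^sub>m mat_of_rows_list 3
     [[-4, -2,  1],
      [ 1, -3, -5],
      [ 7,  1, -2]]"

end

theory Submission
  imports Defs
begin

text \<open>Put \<open>B = 7 A\<close>. Its characteristic equation is \<open>y\<^sup>3 - y = 68\<close> in the shifted variable
  \<open>y = \<mu> + 3\<close> (where \<open>\<mu>\<close> is an eigenvalue of \<open>B\<close>), which bounds all eigenvalues of \<open>B\<close> by 7.
  The inverse of \<open>A\<close> has the strict checkerboard sign pattern, so it maps every nonzero
  vector of weak sign pattern \<open>(+,-,+)\<close> to one of strict sign pattern \<open>(+,-,+)\<close>;
  this is the contrapositive of strong 2-positivity.
  Finally, \<open>v = (5, 4, -7)\<close> satisfies \<open>A v = (-5, 4, 53/7)\<close>. Every entry of \<open>A v\<close> has at least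
  the absolute value of the corresponding entry of \<open>v\<close>, so no diagonal quadratic form with
  positive coefficients decreases along \<open>v\<close>.\<close>

section \<open>Matrix-vector arithmetic in dimension 3\<close>

lemma sum_atLeast0_lessThan_3: "(\<Sum>i = 0..<3. f i) = f 0 + f 1 + f (2::nat)"
  for f :: "nat \<Rightarrow> 'a :: comm_monoid_add"
  by (simp add: numeral_3_eq_3 numeral_2_eq_2 add.assoc)

lemma all_less_3: "(\<forall>i<3. P i) \<longleftrightarrow> P 0 \<and> P 1 \<and> P (2::nat)"
  by (auto simp: less_Suc_eq numeral_3_eq_3 numeral_2_eq_2)

lemma A_counterexample_carrier: "A_counterexample \<in> carrier_mat 3 3"
  by (rule carrier_matI) (simp_all add: A_counterexample_def mat_of_rows_list_def)

text \<open>The entrywise map \<open>h\<close> lets one computation serve twice: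
  \<open>complex_of_real\<close> for the eigenvalue equation, the identity for the real
  system.\<close>

lemma map_mat_A_counterexample_mult_vec:
  fixes h :: "real \<Rightarrow> 'a :: comm_ring_1"
  assumes "x \<in> carrier_vec 3"
  shows "(map_mat h A_counterexample *\<^sub>v x) $ 0 =
           h (-4/7) * x $ 0 + h (-2/7) * x $ 1 + h (1/7) * x $ 2"
    and "(map_mat h A_counterexample *\<^sub>v x) $ 1 =
           h (1/7) * x $ 0 + h (-3/7) * x $ 1 + h (-5/7) * x $ 2"
    and "(map_mat h A_counterexample *\<^sub>v x) $ 2 =
           h 1 * x $ 0 + h (1/7) * x $ 1 + h (-2/7) * x $ 2"
  using assms
  by (simp_all add: A_counterexample_def mat_of_rows_list_def scalar_prod_def sum_atLeast0_lessThan_3)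

lemma A_counterexample_mult_vec:
  assumes "x \<in> carrier_vec 3"
  shows "(A_counterexample *\<^sub>v x) $ 0 = (-4 * x $ 0 - 2 * x $ 1 + x $ 2) / 7"
    and "(A_counterexample *\<^sub>v x) $ 1 = (x $ 0 - 3 * x $ 1 - 5 * x $ 2) / 7"
    and "(A_counterexample *\<^sub>v x) $ 2 = (7 * x $ 0 + x $ 1 - 2 * x $ 2) / 7"
proof -
  have "map_mat (\<lambda>a. a) A_counterexample = A_counterexample"
    by (rule eq_matI) auto
  then show "(A_counterexample *\<^sub>v x) $ 0 = (-4 * x $ 0 - 2 * x $ 1 + x $ 2) / 7"
    and "(A_counterexample *\<^sub>v x) $ 1 = (x $ 0 - 3 * x $ 1 - 5 * x $ 2) / 7"
    and "(A_counterexample *\<^sub>v x) $ 2 = (7 * x $ 0 + x $ 1 - 2 * x $ 2) / 7"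
    using map_mat_A_counterexample_mult_vec[OF assms, of "\<lambda>a. a"]
    by (simp_all add: field_simps)
qed

lemma vec_3_nonzero_entry:
  assumes "x \<in> carrier_vec 3" "x \<noteq> 0\<^sub>v 3"
  shows "x $ 0 \<noteq> 0 \<or> x $ 1 \<noteq> 0 \<or> x $ 2 \<noteq> 0"
proof (rule ccontr)
  assume "\<not> ?thesis"
  then have "\<forall>i<3. x $ i = 0"
    by (simp add: all_less_3)
  with assms show False
    by (auto intro: eq_vecI)
qed

subsection \<open>Spectral radius\<close>

text \<open>Multiplying the eigenvector equation by an adjugate annihilates every entry of
  \<open>v\<close> by the characteristic polynomial, so no determinant is evaluated. The shift by 3
  removes the quadratic term, since \<open>B\<close> has trace -9.\<close>

lemma eigenvalue_A_counterexample_cubic: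
  assumes "eigenvalue (map_mat complex_of_real A_counterexample) e"
  shows "(7 * e + 3) ^ 3 - (7 * e + 3) = 68"
proof -
  let ?A = "map_mat complex_of_real A_counterexample"
  obtain v where v: "v \<in> carrier_vec 3" "v \<noteq> 0\<^sub>v 3" and ev: "?A *\<^sub>v v = e \<cdot>\<^sub>v v"
    using assms A_counterexample_carrier unfolding eigenvalue_def eigenvector_def by auto
  define a b c where abc: "a = v $ 0" "b = v $ 1" "c = v $ 2"
  define y where "y = 7 * e + 3"
  have "(?A *\<^sub>v v) $ i = e * v $ i" if "i < 3" for i
    using ev that v by auto
  moreover have "7 * (?A *\<^sub>v v) $ 0 = c - 4 * a - 2 * b"
    "7 * (?A *\<^sub>v v) $ 1 = a - 3 * b - 5 * c" "7 * (?A *\<^sub>v v) $ 2 = 7 * a + b - 2 * c"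
    unfolding map_mat_A_counterexample_mult_vec[OF v(1)] abc by (simp_all add: field_simps)
  ultimately have rows: "7 * (e * a) = c - 4 * a - 2 * b" "7 * (e * b) = a - 3 * b - 5 * c"
    "7 * (e * c) = 7 * a + b - 2 * c"
    unfolding abc by simp_all
  have "(y + 1) * a + 2 * b - c = 0"
    using rows(1) by (simp add: y_def algebra_simps)
  moreover have "y * b - a + 5 * c = 0"
    using rows(2) by (simp add: y_def algebra_simps)
  moreover have "(y - 1) * c - 7 * a - b = 0"
    using rows(3) by (simp add: y_def algebra_simps)
  \<comment> \<open>The coefficients below are the entries of the adjugate of \<open>\<mu> - B\<close>.\<close>
  moreover have "(y ^ 3 - y - 68) * a = (y * (y - 1) + 5) * ((y + 1) * a + 2 * b - c)
      - (2 * y - 3) * (y * b - a + 5 * c) + (y + 10) * ((y - 1) * c - 7 * a - b)"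
    by (simp add: power3_eq_cube algebra_simps)
  moreover have "(y ^ 3 - y - 68) * b = (y - 36) * ((y + 1) * a + 2 * b - c)
      + (y * y - 8) * (y * b - a + 5 * c) - (5 * y + 4) * ((y - 1) * c - 7 * a - b)"
    by (simp add: power3_eq_cube algebra_simps)
  moreover have "(y ^ 3 - y - 68) * c = (7 * y + 1) * ((y + 1) * a + 2 * b - c)
      + (y - 13) * (y * b - a + 5 * c) + (y * (y + 1) + 2) * ((y - 1) * c - 7 * a - b)"
    by (simp add: power3_eq_cube algebra_simps)
  ultimately have "(y ^ 3 - y - 68) * a = 0" "(y ^ 3 - y - 68) * b = 0" "(y ^ 3 - y - 68) * c = 0"
    by (simp_all only: mult_zero_right add_0_left diff_zero)
  moreover have "a \<noteq> 0 \<or> b \<noteq> 0 \<or> c \<noteq> 0"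
    unfolding abc by (rule vec_3_nonzero_entry[OF v])
  ultimately show ?thesis
    unfolding y_def by auto
qed

text \<open>The imaginary part of the cubic factors through \<open>b\<close>, which separates real
  from non-real roots. In both cases the goal becomes a quadratic inequality in \<open>y\<close>,
  and the real part of the cubic confines \<open>y\<close> to a suitable interval.\<close>

lemma norm_less_7_if_cubic:
  fixes z :: complex
  assumes "(z + 3) ^ 3 - (z + 3) = 68"
  shows "cmod z < 7"
proof -
  define y b where yb: "y = Re z + 3" "b = Im z"
  have z: "z + 3 = Complex y b"
    by (simp add: complex_eq_iff yb)
  from assms[unfolded z]
  have re: "y ^ 3 - 3 * y * b\<^sup>2 - y = 68" and im: "b * (3 * y\<^sup>2 - b\<^sup>2 - 1) = 0"
    by (simp_all add: complex_eq_iff power3_eq_cube power2_eq_square algebra_simps)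
  have "(y - 3)\<^sup>2 + b\<^sup>2 < 49"
  proof (cases "b = 0")
    case True
    with re have y: "y * (y * y - 1) = 68"
      by (simp add: power3_eq_cube algebra_simps)
    \<comment> \<open>With \<open>b = 0\<close> the goal is \<open>(y - 3)\<^sup>2 < 49\<close>,
      that is, -4 < y < 10.\<close>
    have "-4 < y"
    proof (rule ccontr)
      assume "\<not> -4 < y"
      moreover from this have "4 * 4 \<le> (- y) * (- y)"
        by (intro mult_mono) auto
      ultimately have "y * (y * y - 1) \<le> 0"
        by (intro mult_nonpos_nonneg) auto
      with y show False by simp
    qed
    moreover have "y < 10"
    proof (rule ccontr)
      assume "\<not> y < 10"
      then have "10 * (10 * 10 - 1) \<le> y * (y * y - 1)"
        by (intro mult_mono diff_mono) auto
      with y show False by simp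
    qed
    ultimately have "0 < (y + 4) * (10 - y)"
      by simp
    with True show ?thesis
      by (simp add: power2_eq_square algebra_simps)
  next
    case False
    with im have b: "b\<^sup>2 = 3 * y\<^sup>2 - 1" by simp
    from re[unfolded b] have y: "y * (4 * y * y - 1) = - 34"
      by (simp add: power3_eq_cube power2_eq_square algebra_simps)
    \<comment> \<open>Substituting \<open>b\<^sup>2\<close> turns the left side of the goal into
      \<open>48 - 2 * (2 * y + 5) * (4 - y)\<close>, so -5/2 < y < 4 suffices. Outside this interval
      the cubic is already too large in absolute value: at -5/2 it equals -60, at 4 it equals
      252.\<close>
    have "-5/2 < y"
    proof (rule ccontr)
      assume "\<not> -5/2 < y"
      then have "5/2 * (4 * (5/2) * (5/2) - 1) \<le> (- y) * (4 * (- y) * (- y) - 1)"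
        by (intro mult_mono diff_mono) auto
      with y show False by simp
    qed
    moreover have "y < 4"
    proof (rule ccontr)
      assume "\<not> y < 4"
      then have "4 * (4 * 4 * 4 - 1) \<le> y * (4 * y * y - 1)"
        by (intro mult_mono diff_mono) auto
      with y show False by simp
    qed
    ultimately have "0 < (2 * y + 5) * (4 - y)"
      by simp
    then show ?thesis
      unfolding b by (simp add: power2_eq_square algebra_simps)
  qed
  moreover have "(cmod z)\<^sup>2 = (y - 3)\<^sup>2 + b\<^sup>2"
    by (simp add: cmod_power2 yb)
  ultimately have "(cmod z)\<^sup>2 < 7\<^sup>2" by simp
  then show ?thesis
    by (rule power2_less_imp_less) simp
qed

lemma schur_A_counterexample: "schur A_counterexample"
proof -
  let ?A = "map_mat complex_of_real A_counterexample"
  have A: "?A \<in> carrier_mat 3 3"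
    using A_counterexample_carrier by simp
  obtain e where e: "spectral_radius ?A = cmod e" "e \<in> spectrum ?A"
    using spectral_radius_mem_max(1)[OF A] by auto
  then have "(7 * e + 3) ^ 3 - (7 * e + 3) = 68"
    by (intro eigenvalue_A_counterexample_cubic) (simp add: spectrum_def)
  then have "cmod (7 * e) < 7"
    by (rule norm_less_7_if_cubic)
  then show ?thesis
    by (simp add: schur_def e(1) norm_mult)
qed

subsection \<open>Strong 2-positivity\<close>

text \<open>For n = 3 and k = 2, violating the bound k - 1 means having both possible sign
  variations.\<close>

lemma sign_variations_triple_gt_1_iff:
  "1 < sign_variations [a, b, c] \<longleftrightarrow> a * b < 0 \<and> b * c < 0"
proof -
  have split: "{i. Suc i < length [a, b, c] \<and> P i} =
      (if P 0 then {0} else {}) \<union> (if P 1 then {1} else {})" for P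
  proof -
    have index: "Suc i < length [a, b, c] \<longleftrightarrow> i = 0 \<or> i = 1" for i
      by auto
    show ?thesis
      unfolding index by (intro Set.set_eqI iffI) (auto split: if_splits)
  qed
  show ?thesis
    unfolding sign_variations_def split by simp
qed

lemma list_length_3_eq: "length xs = 3 \<Longrightarrow> xs = [xs ! 0, xs ! 1, xs ! 2]"
  by (auto simp: numeral_3_eq_3 numeral_2_eq_2 length_Suc_conv)

lemma s_minus_gt_1_if_alternating:
  assumes "x \<in> carrier_vec 3" "x $ 0 * x $ 1 < 0" "x $ 1 * x $ 2 < 0"
  shows "1 < s_minus x"
proof -
  have "list_of_vec x = [x $ 0, x $ 1, x $ 2]"
    using list_length_3_eq[of "list_of_vec x"] assms(1) by (simp add: list_of_vec_index)
  then have "filter (\<lambda>a. a \<noteq> 0) (list_of_vec x) = [x $ 0, x $ 1, x $ 2]"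
    using assms(2,3) by auto
  then show ?thesis
    unfolding s_minus_def using assms(2,3) by (simp only: sign_variations_triple_gt_1_iff)
qed

text \<open>\<open>Max\<close> is attained on a finite nonempty set: the number of variations is at
  most the dimension, and replacing every zero by 1 gives a member.\<close>

lemma s_plus_attained:
  obtains ys where "ys \<in> zero_replacements y" "s_plus y = sign_variations ys"
proof -
  let ?Z = "zero_replacements y"
  have "sign_variations ys \<le> dim_vec y" if "ys \<in> ?Z" for ys
  proof -
    have "sign_variations ys \<le> card {..<length ys}"
      unfolding sign_variations_def by (rule card_mono) auto
    with that show ?thesis
      by (simp add: zero_replacements_def)
  qed
  then have "sign_variations ` ?Z \<subseteq> {..dim_vec y}"
    by auto
  then have "finite (sign_variations ` ?Z)"
    by (rule finite_subset) simp
  moreover have "map (\<lambda>i. if y $ i = 0 then 1 else y $ i) [0..<dim_vec y] \<in> ?Z"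
    by (simp add: zero_replacements_def)
  ultimately have "s_plus y \<in> sign_variations ` ?Z"
    unfolding s_plus_def by (intro Max_in) auto
  with that show ?thesis by blast
qed

text \<open>A replacement attaining the maximum alternates strictly and agrees with \<open>y\<close>
  at its nonzero entries; the other entries are 0 and fit either weak sign.\<close>

lemma weakly_alternating_if_s_plus_gt_1:
  assumes y: "y \<in> carrier_vec 3" and "1 < s_plus y"
  shows "y $ 0 \<ge> 0 \<and> y $ 1 \<le> 0 \<and> y $ 2 \<ge> 0 \<or> y $ 0 \<le> 0 \<and> y $ 1 \<ge> 0 \<and> y $ 2 \<le> 0"
proof -
  obtain ys where ys: "ys \<in> zero_replacements y" and "s_plus y = sign_variations ys"
    by (rule s_plus_attained)
  moreover from ys y have "length ys = 3"
    and entries: "\<And>i. i < 3 \<Longrightarrow> y $ i \<noteq> 0 \<Longrightarrow> ys ! i = y $ i"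
    by (auto simp: zero_replacements_def)
  ultimately have "1 < sign_variations [ys ! 0, ys ! 1, ys ! 2]"
    using assms(2) list_length_3_eq[of ys] by simp
  then have "ys ! 0 * ys ! 1 < 0" "ys ! 1 * ys ! 2 < 0"
    unfolding sign_variations_triple_gt_1_iff by auto
  with entries[of 0] entries[of 1] entries[of 2] show ?thesis
    by (fastforce simp: mult_less_0_iff)
qed

lemma strongly_2_positive_A_counterexample: "strongly_k_positive 3 2 A_counterexample"
proof -
  have "s_plus (A_counterexample *\<^sub>v x) \<le> 1"
    if x: "x \<in> carrier_vec 3" "x \<noteq> 0\<^sub>v 3" and "s_minus x \<le> 1" for x
  proof (rule ccontr)
    assume "\<not> s_plus (A_counterexample *\<^sub>v x) \<le> 1"
    moreover have "A_counterexample *\<^sub>v x \<in> carrier_vec 3"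
      using A_counterexample_carrier x(1) by simp
    \<comment> \<open>With \<open>y = 7 A x\<close>, inverting \<open>B\<close> gives 44 x0 = 11 y0
      - 3 y1 + 13 y2, 44 x1 = -33 y0 + y1 - 19 y2 and 44 x2 = 22 y0 - 10 y1 + 14 y2. For weakly
      alternating \<open>y\<close> no terms cancel, so a zero entry of \<open>x\<close> would force
      \<open>y = 0\<close> and hence \<open>x = 0\<close>.\<close>
    ultimately have
      "x $ 0 > 0 \<and> x $ 1 < 0 \<and> x $ 2 > 0 \<or> x $ 0 < 0 \<and> x $ 1 > 0 \<and> x $ 2 < 0"
      using weakly_alternating_if_s_plus_gt_1[of "A_counterexample *\<^sub>v x"]
        vec_3_nonzero_entry[OF x]
      unfolding A_counterexample_mult_vec[OF x(1)] by (simp add: divide_simps) argo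
    then have "1 < s_minus x"
      using x(1) by (intro s_minus_gt_1_if_alternating) (auto simp: mult_less_0_iff)
    with \<open>s_minus x \<le> 1\<close> show False by simp
  qed
  then show ?thesis
    using A_counterexample_carrier
    by (auto simp: strongly_k_positive_def P_minus_def P_plus_def)
qed

subsection \<open>Diagonal stability\<close>

lemma quadratic_form_diagonal:
  fixes D :: "'a :: comm_ring_1 mat"
  assumes D: "D \<in> carrier_mat n n" "diagonal_mat D" and x: "x \<in> carrier_vec n"
  shows "x \<bullet> (D *\<^sub>v x) = (\<Sum>i = 0..<n. D $$ (i, i) * (x $ i)\<^sup>2)"
proof -
  have "(D *\<^sub>v x) $ i = D $$ (i, i) * x $ i" if "i < n" for i
  proof -
    have "(D *\<^sub>v x) $ i = (\<Sum>j = 0..<n. D $$ (i, j) * x $ j)"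
      using D(1) x that by (simp add: scalar_prod_def)
    also have "\<dots> = (\<Sum>j = 0..<n. if j = i then D $$ (i, i) * x $ i else 0)"
      using D that by (intro sum.cong) (auto simp: diagonal_mat_def)
    finally show ?thesis using that by simp
  qed
  then show ?thesis
    using D(1) x by (simp add: scalar_prod_def power2_eq_square ac_simps)
qed

lemma quadratic_form_congruence:
  fixes A D :: "'a :: comm_ring_1 mat"
  assumes A: "A \<in> carrier_mat n n" and D: "D \<in> carrier_mat n n" and x: "x \<in> carrier_vec n"
  shows "x \<bullet> ((A\<^sup>T * D * A) *\<^sub>v x) = (A *\<^sub>v x) \<bullet> (D *\<^sub>v (A *\<^sub>v x))"
proof -
  have "(A\<^sup>T * D * A) *\<^sub>v x = A\<^sup>T *\<^sub>v (D *\<^sub>v (A *\<^sub>v x))"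
    using A D x by (simp add: assoc_mult_mat_vec[of _ n n _ n])
  also have "x \<bullet> \<dots> = (A *\<^sub>v x) \<bullet> (D *\<^sub>v (A *\<^sub>v x))"
    using A D x
    by (metis mult_mat_vec_carrier transpose_vec_mult_scalar transpose_carrier_mat transpose_transpose)
  finally show ?thesis .
qed

lemma not_mat_prec_A_counterexample:
  assumes D: "D \<in> carrier_mat 3 3" "diagonal_mat D" and pos: "\<forall>i<3. D $$ (i, i) > 0"
  shows "\<not> mat_prec 3 (A_counterexample\<^sup>T * D * A_counterexample) D"
proof
  let ?A = "A_counterexample"
  let ?M = "?A\<^sup>T * D * ?A"
  define v :: "real vec" where "v = vec_of_list [5, 4, -7]"
  assume "mat_prec 3 ?M D"
  have v: "v \<in> carrier_vec 3" "v $ 0 = 5" "v $ 1 = 4" "v $ 2 = -7"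
    by (simp_all add: v_def vec_index_vCons carrier_vecI)
  have Av: "?A *\<^sub>v v \<in> carrier_vec 3"
    using A_counterexample_carrier v(1) by simp
  have M: "?M \<in> carrier_mat 3 3"
    using A_counterexample_carrier D(1) by simp
  have "v \<noteq> 0\<^sub>v 3"
    using v(2) by auto
  with \<open>mat_prec 3 ?M D\<close> v(1) have "0 < v \<bullet> ((D - ?M) *\<^sub>v v)"
    by (simp add: mat_prec_def positive_definite_def)
  also have "\<dots> = v \<bullet> (D *\<^sub>v v) - v \<bullet> (?M *\<^sub>v v)"
    using D(1) M v(1)
    by (simp add: minus_mult_distrib_mat_vec[of _ 3 3] scalar_prod_minus_distrib[of _ 3])
  also have "\<dots> = v \<bullet> (D *\<^sub>v v) - (?A *\<^sub>v v) \<bullet> (D *\<^sub>v (?A *\<^sub>v v))"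
    using quadratic_form_congruence[OF A_counterexample_carrier D(1) v(1)] by simp
  \<comment> \<open>The first two entries of \<open>v\<close> and \<open>A v\<close> agree up to
    sign, so their contributions cancel; in the last one 53/7 exceeds 7.\<close>
  also have "\<dots> = D $$ (2, 2) * (49 - (53 / 7)\<^sup>2)"
    unfolding quadratic_form_diagonal[OF D v(1)] quadratic_form_diagonal[OF D Av]
      sum_atLeast0_lessThan_3 A_counterexample_mult_vec[OF v(1)] v(2-)
    by (simp add: power2_eq_square)
  also have "\<dots> \<le> 0"
    using pos[rule_format, of 2] by (simp add: mult_le_0_iff power2_eq_square)
  finally show False by simp
qed

theorem mainTheorem1:
  shows "schur A_counterexample \<and>
    strongly_k_positive 3 2 A_counterexample \<and>
    \<not> (\<exists>D \<in> carrier_mat 3 3. diagonal_mat D \<and> (\<forall>i<3. D $$ (i, i) > 0) \<and>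
        mat_prec 3 (A_counterexample\<^sup>T * D * A_counterexample) D)"
  using schur_A_counterexample strongly_2_positive_A_counterexample
    not_mat_prec_A_counterexample by blast

end
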